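(* Let $H_A,H_B$ be Hilbert spaces of the same finite dimension $n$ with orthonormal bases $\{|i\rangle_A\}_{i=1}^n$, $\{|i\rangle_B\}_{i=1}^n$, let $H_E$ be a finite-dimensional Hilbert space with a fixed unit vector $|0\rangle_E$, let $U_{BE}$ be a unitary on $H_B\otimes H_E$, and put $U_{ABE}=I_A\otimes U_{BE}$. Let $|\psi_M\rangle_{AB}=\sum_{i=1}^n|i\rangle_A|i\rangle_B$ be the (unnormalized) maximally entangled state. For $|\psi\rangle_{AB}\in H_A\otimes H_B$ put $\rho^{\psi}=P\big(U_{ABE}|\psi\rangle_{AB}|0\rangle_E\big)$, $\rho^{\psi}_{AE}=\mathrm{tr}_B(\rho^\psi)$ and $\rho^\psi_{AB}=\mathrm{tr}_E(\rho^\psi)$. Let $T$ be a map of the form $$T(X)=\sum_{j=1}^r(I_A\otimes F_j)X(I_A\otimes F_j)^*,\qquad F_j:H_E\to H_B,\qquad\sum_{j=1}^rF_j^*F_j=I_E.$$ If the output state $U_{ABE}|\psi_M\rangle_{AB}|0\rangle_E$ is $E\to B$ degradable with $T$, i.e. $T(\rho^{\psi_M}_{AE})=\rho^{\psi_M}_{AB}$, then for every input state $|\psi\rangle_{AB}\in H_A\otimes H_B$ the output state $U_{ABE}|\psi\rangle_{AB}|0\rangle_E$ is $E\to B$ degradable with the same $T$, i.e. $T(\rho^{\psi}_{AE})=\rho^{\psi}_{AB}$.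
   Context: $P(|\varphi\rangle)=|\varphi\rangle\langle\varphi|$. $\mathrm{tr}_B$ and $\mathrm{tr}_E$ are the partial traces over $H_B$ and $H_E$ on $H_A\otimes H_B\otimes H_E$. A vector $|\tilde\psi\rangle\in H_A\otimes H_B\otimes H_E$ is called $E\to B$ degradable if there is a map $T$ of the form displayed in the claim (a quantum channel acting only on $E$, with arbitrary number $r$ of Kraus operators) such that $T(\mathrm{tr}_B|\tilde\psi\rangle\langle\tilde\psi|)=\mathrm{tr}_E|\tilde\psi\rangle\langle\tilde\psi|$. Vectors representing states need not be normalized. *)

theory Defs
  imports "HOL-Analysis.Analysis"
begin

text \<open>
  Finite-dimensional Hilbert spaces are taken in coordinates: a \<open>d\<close>-dimensional space is
  \<^typ>\<open>complex ^ 'd\<close> with \<open>CARD('d) = d\<close>, and an operator \<open>C^'d \<rightarrow> C^'c\<close> is a matrix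
  \<^typ>\<open>complex ^ 'd ^ 'c\<close>. The tensor product of spaces indexed by \<open>'a\<close> and \<open>'b\<close> is the space
  indexed by \<open>'a \<times> 'b\<close>; threefold products are nested to the right, so
  \<open>H_A \<otimes> H_B \<otimes> H_E\<close> is \<open>complex ^ ('a \<times> 'b \<times> 'e)\<close>.
\<close>

text \<open>The Hermitian inner product, conjugate-linear in the first argument. (The library's
  \<open>\<bullet>\<close> on \<^typ>\<open>complex ^ 'd\<close> is only its real part.)\<close>

definition herm_inner :: "complex ^ 'd \<Rightarrow> complex ^ 'd \<Rightarrow> complex" where
  "herm_inner u v = (\<Sum>i\<in>UNIV. cnj (u $ i) * v $ i)"

text \<open>\<open>vec.span\<close> is the span over \<^typ>\<open>complex\<close>.\<close>

definition is_onb :: "nat \<Rightarrow> (nat \<Rightarrow> complex ^ 'd) \<Rightarrow> bool" where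
  "is_onb n f \<longleftrightarrow>
     (\<forall>i\<in>{1..n}. \<forall>j\<in>{1..n}. herm_inner (f i) (f j) = (if i = j then 1 else 0)) \<and>
     vec.span (f ` {1..n}) = UNIV"

definition ctranspose :: "complex ^ 'c ^ 'd \<Rightarrow> complex ^ 'd ^ 'c" where
  "ctranspose M = (\<chi> i j. cnj (M $ j $ i))"

definition is_unitary :: "complex ^ 'd ^ 'd \<Rightarrow> bool" where
  "is_unitary M \<longleftrightarrow> M ** ctranspose M = mat 1 \<and> ctranspose M ** M = mat 1"

definition ket_tensor :: "complex ^ 'a \<Rightarrow> complex ^ 'b \<Rightarrow> complex ^ ('a \<times> 'b)" where
  "ket_tensor u v = (\<chi> p. u $ fst p * v $ snd p)"

definition op_tensor ::
    "complex ^ 'c ^ 'a \<Rightarrow> complex ^ 'd ^ 'b \<Rightarrow> complex ^ ('c \<times> 'd) ^ ('a \<times> 'b)" where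
  "op_tensor M N = (\<chi> p q. M $ fst p $ fst q * N $ snd p $ snd q)"

definition ket_assoc :: "complex ^ (('a::finite \<times> 'b::finite) \<times> 'e::finite) \<Rightarrow> complex ^ ('a \<times> 'b \<times> 'e)" where
  "ket_assoc v = (\<chi> p. case p of (a, b, e) \<Rightarrow> v $ ((a, b), e))"

definition ket_proj :: "complex ^ 'd \<Rightarrow> complex ^ 'd ^ 'd" where
  "ket_proj v = (\<chi> i j. v $ i * cnj (v $ j))"

definition tr_B ::
    "complex ^ ('a::finite \<times> 'b::finite \<times> 'e::finite) ^ ('a \<times> 'b \<times> 'e) \<Rightarrow> complex ^ ('a \<times> 'e) ^ ('a \<times> 'e)" where
  "tr_B X = (\<chi> p q. \<Sum>b\<in>UNIV. X $ (fst p, b, snd p) $ (fst q, b, snd q))"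

definition tr_E ::
    "complex ^ ('a::finite \<times> 'b::finite \<times> 'e::finite) ^ ('a \<times> 'b \<times> 'e) \<Rightarrow> complex ^ ('a \<times> 'b) ^ ('a \<times> 'b)" where
  "tr_E X = (\<chi> p q. \<Sum>e\<in>UNIV. X $ (fst p, snd p, e) $ (fst q, snd q, e))"

definition EB_channel ::
    "(complex ^ ('a::finite \<times> 'e::finite) ^ ('a \<times> 'e) \<Rightarrow> complex ^ ('a \<times> 'b::finite) ^ ('a \<times> 'b)) \<Rightarrow> bool" where
  "EB_channel T \<longleftrightarrow>
     (\<exists>(r :: nat) (F :: nat \<Rightarrow> complex ^ 'e ^ 'b).
        (\<Sum>j = 1..r. ctranspose (F j) ** F j) = mat 1 \<and>
        (\<forall>X. T X = (\<Sum>j = 1..r. op_tensor (mat 1) (F j) ** X **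
                                    ctranspose (op_tensor (mat 1) (F j)))))"

definition EB_degradable_with ::
    "(complex ^ ('a::finite \<times> 'e::finite) ^ ('a \<times> 'e) \<Rightarrow> complex ^ ('a \<times> 'b::finite) ^ ('a \<times> 'b)) \<Rightarrow>
     complex ^ ('a \<times> 'b \<times> 'e) \<Rightarrow> bool" where
  "EB_degradable_with T v \<longleftrightarrow> EB_channel T \<and> T (tr_B (ket_proj v)) = tr_E (ket_proj v)"

text \<open>The output \<open>(I_A \<otimes> U_BE) (\<psi>_AB \<otimes> z_E)\<close>, where \<open>z\<close> is the fixed unit vector of \<open>H_E\<close>.\<close>

definition output_state ::
    "complex ^ ('b::finite \<times> 'e::finite) ^ ('b \<times> 'e) \<Rightarrow> complex ^ 'e \<Rightarrow> complex ^ ('a::finite \<times> 'b) \<Rightarrow>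
     complex ^ ('a \<times> 'b \<times> 'e)" where
  "output_state U z \<psi> = op_tensor (mat 1) U *v ket_assoc (ket_tensor \<psi> z)"

definition max_entangled ::
    "nat \<Rightarrow> (nat \<Rightarrow> complex ^ 'a) \<Rightarrow> (nat \<Rightarrow> complex ^ 'b) \<Rightarrow> complex ^ ('a \<times> 'b)" where
  "max_entangled n f g = (\<Sum>i = 1..n. ket_tensor (f i) (g i))"

end

theory Submission
  imports Defs
begin

text \<open>
  Every bipartite vector is \<open>(M \<otimes> I) \<psi>_M\<close> for some matrix \<open>M\<close> on \<open>H_A\<close>. Operators acting on
  \<open>H_A\<close> only commute with \<open>I_A \<otimes> U_BE\<close>, and conjugation by them commutes with both partial traces
  and with every channel acting on \<open>H_E\<close> only. So conjugating the degradability equation of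
  \<open>\<psi>_M\<close> by \<open>M \<otimes> I\<close> gives that of \<open>(M \<otimes> I) \<psi>_M\<close>.
\<close>

lemma sum_UNIV_prod:
  fixes h :: "'a::finite \<times> 'b::finite \<Rightarrow> 'c::comm_monoid_add"
  shows "(\<Sum>p\<in>UNIV. h p) = (\<Sum>a\<in>UNIV. \<Sum>b\<in>UNIV. h (a, b))"
  unfolding sum.cartesian_product by (simp add: case_prod_beta)

text \<open>The mixed-product rule. With \<open>mat 1\<close> in opposite slots it makes operators
  on different tensor factors commute.\<close>

lemma op_tensor_mult:
  fixes A :: "complex ^ 'c::finite ^ 'a" and B :: "complex ^ 'd::finite ^ 'b"
  shows "op_tensor A B ** op_tensor C D = op_tensor (A ** C) (B ** D)"
  by (simp add: vec_eq_iff op_tensor_def matrix_matrix_mult_def sum_UNIV_prod sum_product ac_simps)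

text \<open>The entries of \<open>mat 1\<close> collapse the sum over the second index. That index
  type stays arbitrary because products are nested to the right: \<open>M\<close> on the first of
  three factors is again \<open>op_tensor M (mat 1)\<close>, now with a pair as second
  index.\<close>

lemma op_tensor_left_mult_ket_nth:
  fixes M :: "complex ^ 'c::finite ^ 'a" and v :: "complex ^ ('c \<times> 'k::finite)"
  shows "(op_tensor M (mat 1) *v v) $ (a, k) = (\<Sum>a'\<in>UNIV. M $ a $ a' * v $ (a', k))"
  by (simp add: op_tensor_def matrix_vector_mult_def mat_def sum_UNIV_prod if_distrib
      [of "\<lambda>x. _ * x"] if_distrib [of "\<lambda>x. x * _"] cong: if_cong)

lemma op_tensor_left_mult_nth:
  fixes M :: "complex ^ 'c::finite ^ 'a" and X :: "complex ^ 'd ^ ('c \<times> 'k::finite)"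
  shows "(op_tensor M (mat 1) ** X) $ (a, k) $ q = (\<Sum>a'\<in>UNIV. M $ a $ a' * X $ (a', k) $ q)"
  by (simp add: op_tensor_def matrix_matrix_mult_def mat_def sum_UNIV_prod if_distrib
      [of "\<lambda>x. _ * x"] if_distrib [of "\<lambda>x. x * _"] cong: if_cong)

lemma mult_ctranspose_op_tensor_left_nth:
  fixes M :: "complex ^ 'c::finite ^ 'a" and X :: "complex ^ ('c \<times> 'k::finite) ^ 'd"
  shows "(X ** ctranspose (op_tensor M (mat 1))) $ p $ (a, k) =
    (\<Sum>a'\<in>UNIV. X $ p $ (a', k) * cnj (M $ a $ a'))"
  by (simp add: op_tensor_def ctranspose_def matrix_matrix_mult_def mat_def sum_UNIV_prod if_distrib
      [of "\<lambda>x. _ * x"] if_distrib [of "\<lambda>x. x * _"] if_distrib [of cnj] cong: if_cong)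

lemma ctranspose_mult:
  fixes A :: "complex ^ 'c::finite ^ 'a"
  shows "ctranspose (A ** B) = ctranspose B ** ctranspose A"
  by (simp add: vec_eq_iff ctranspose_def matrix_matrix_mult_def mult.commute)

text \<open>\<open>M\<close> acts on the first index only and the trace sums over the second, so the
  finite sums can be exchanged. The same argument works for \<open>tr_E\<close>.\<close>

lemma tr_B_ket_proj_local:
  fixes M :: "complex ^ 'a::finite ^ 'a" and v :: "complex ^ ('a \<times> 'b::finite \<times> 'e::finite)"
  shows "tr_B (ket_proj (op_tensor M (mat 1) *v v)) =
    op_tensor M (mat 1) ** tr_B (ket_proj v) ** ctranspose (op_tensor M (mat 1))"
proof -
  have "tr_B (ket_proj (op_tensor M (mat 1) *v v)) $ (a, e) $ (c, f) =
    (op_tensor M (mat 1) ** tr_B (ket_proj v) ** ctranspose (op_tensor M (mat 1))) $ (a, e) $ (c, f)"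
    for a c e f
  proof -
    have "tr_B (ket_proj (op_tensor M (mat 1) *v v)) $ (a, e) $ (c, f) =
      (\<Sum>b\<in>UNIV. \<Sum>c'\<in>UNIV. \<Sum>a'\<in>UNIV.
        M $ a $ a' * (v $ (a', b, e) * cnj (v $ (c', b, f))) * cnj (M $ c $ c'))"
      by (simp add: tr_B_def ket_proj_def op_tensor_left_mult_ket_nth sum_product
          mult_ac) (intro sum.cong refl sum.swap)
    \<comment> \<open>Two exchanges carry the traced index inwards, first past \<open>c'\<close> and
      then past \<open>a'\<close>.\<close>
    also have "\<dots> = (\<Sum>c'\<in>UNIV. \<Sum>a'\<in>UNIV. \<Sum>b\<in>UNIV.
        M $ a $ a' * (v $ (a', b, e) * cnj (v $ (c', b, f))) * cnj (M $ c $ c'))"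
      by (subst sum.swap, rule sum.cong [OF refl], rule sum.swap)
    finally show ?thesis
      by (simp add: op_tensor_left_mult_nth mult_ctranspose_op_tensor_left_nth tr_B_def
          ket_proj_def sum_distrib_left sum_distrib_right)
  qed
  then show ?thesis by (simp add: vec_eq_iff)
qed

lemma tr_E_ket_proj_local:
  fixes M :: "complex ^ 'a::finite ^ 'a" and v :: "complex ^ ('a \<times> 'b::finite \<times> 'e::finite)"
  shows "tr_E (ket_proj (op_tensor M (mat 1) *v v)) =
    op_tensor M (mat 1) ** tr_E (ket_proj v) ** ctranspose (op_tensor M (mat 1))"
proof -
  have "tr_E (ket_proj (op_tensor M (mat 1) *v v)) $ (a, b) $ (c, d) =
    (op_tensor M (mat 1) ** tr_E (ket_proj v) ** ctranspose (op_tensor M (mat 1))) $ (a, b) $ (c, d)"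
    for a c b d
  proof -
    have "tr_E (ket_proj (op_tensor M (mat 1) *v v)) $ (a, b) $ (c, d) =
      (\<Sum>e\<in>UNIV. \<Sum>c'\<in>UNIV. \<Sum>a'\<in>UNIV.
        M $ a $ a' * (v $ (a', b, e) * cnj (v $ (c', d, e))) * cnj (M $ c $ c'))"
      by (simp add: tr_E_def ket_proj_def op_tensor_left_mult_ket_nth sum_product
          mult_ac) (intro sum.cong refl sum.swap)
    also have "\<dots> = (\<Sum>c'\<in>UNIV. \<Sum>a'\<in>UNIV. \<Sum>e\<in>UNIV.
        M $ a $ a' * (v $ (a', b, e) * cnj (v $ (c', d, e))) * cnj (M $ c $ c'))"
      by (subst sum.swap, rule sum.cong [OF refl], rule sum.swap)
    finally show ?thesis
      by (simp add: op_tensor_left_mult_nth mult_ctranspose_op_tensor_left_nth tr_E_def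
          ket_proj_def sum_distrib_left sum_distrib_right)
  qed
  then show ?thesis by (simp add: vec_eq_iff)
qed

text \<open>Appending \<open>z\<close> and applying \<open>U\<close> both leave the first factor
  alone, so \<open>M\<close> can be pulled out through each of them.\<close>

lemma output_state_local:
  fixes M :: "complex ^ 'a::finite ^ 'a" and \<psi> :: "complex ^ ('a \<times> 'b::finite)"
    and z :: "complex ^ 'e::finite"
  shows "output_state U z (op_tensor M (mat 1) *v \<psi>) = op_tensor M (mat 1) *v output_state U z \<psi>"
proof -
  have "ket_assoc (ket_tensor (op_tensor M (mat 1) *v \<psi>) z) =
    op_tensor M (mat 1) *v ket_assoc (ket_tensor \<psi> z)"
    by (simp add: vec_eq_iff ket_assoc_def ket_tensor_def op_tensor_left_mult_ket_nth
        sum_distrib_right mult.assoc)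
  then show ?thesis
    by (simp add: output_state_def matrix_vector_mul_assoc op_tensor_mult)
qed

lemma matrix_mult_sum_distrib:
  fixes A :: "complex ^ 'c::finite ^ 'a" and B :: "complex ^ 'b ^ 'd::finite"
  shows "A ** (\<Sum>j\<in>J. X j) ** B = (\<Sum>j\<in>J. A ** X j ** B)"
proof (induction J rule: infinite_finite_induct)
  case (insert j J)
  then show ?case
    by (simp add: vec_eq_iff matrix_matrix_mult_def sum.distrib ring_distribs)
qed simp_all

text \<open>\<open>M\<close> can be moved past each Kraus operator separately, because the two act
  on different factors.\<close>

lemma EB_channel_conj_local:
  fixes M :: "complex ^ 'a::finite ^ 'a" and X :: "complex ^ ('a \<times> 'e::finite) ^ ('a \<times> 'e)"
    and T :: "complex ^ ('a \<times> 'e) ^ ('a \<times> 'e) \<Rightarrow> complex ^ ('a \<times> 'b::finite) ^ ('a \<times> 'b)"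
  assumes "EB_channel T"
  shows "T (op_tensor M (mat 1) ** X ** ctranspose (op_tensor M (mat 1))) =
    op_tensor M (mat 1) ** T X ** ctranspose (op_tensor M (mat 1))"
proof -
  obtain r and F :: "nat \<Rightarrow> complex ^ 'e ^ 'b"
    where T: "\<And>X. T X = (\<Sum>j = 1..r. op_tensor (mat 1) (F j) ** X **
      ctranspose (op_tensor (mat 1) (F j)))"
    using assms unfolding EB_channel_def by blast
  have "op_tensor (mat 1) G ** (op_tensor M (mat 1) ** X ** ctranspose (op_tensor M (mat 1))) **
      ctranspose (op_tensor (mat 1) G) =
    op_tensor M (mat 1) ** (op_tensor (mat 1) G ** X ** ctranspose (op_tensor (mat 1) G)) **
      ctranspose (op_tensor M (mat 1))" for G :: "complex ^ 'e ^ 'b"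
  proof -
    \<comment> \<open>The two occurrences of \<open>op_tensor M (mat 1)\<close> differ in type: as
      \<open>G\<close> maps \<open>'e\<close> to \<open>'b\<close>, the identity lives on
      \<open>'e\<close> on the left and on \<open>'b\<close> on the right.\<close>
    have comm: "op_tensor (mat 1) G ** op_tensor M (mat 1) = op_tensor M (mat 1) ** op_tensor (mat 1) G"
      by (simp add: op_tensor_mult)
    have "op_tensor (mat 1) G ** (op_tensor M (mat 1) ** X ** ctranspose (op_tensor M (mat 1))) **
      ctranspose (op_tensor (mat 1) G) = (op_tensor (mat 1) G ** op_tensor M (mat 1)) ** X **
        ctranspose (op_tensor (mat 1) G ** op_tensor M (mat 1))"
      by (simp add: ctranspose_mult matrix_mul_assoc)
    then show ?thesis
      unfolding comm by (simp add: ctranspose_mult matrix_mul_assoc)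
  qed
  then show ?thesis
    by (simp add: T matrix_mult_sum_distrib)
qed

text \<open>The vectors that equal their own expansion form a subspace. By orthonormality it
  contains every \<open>g i\<close>, hence also their span, which is the whole space.\<close>

lemma is_onb_expansion:
  fixes g :: "nat \<Rightarrow> complex ^ 'd::finite"
  assumes "is_onb n g"
  shows "(\<Sum>i = 1..n. herm_inner (g i) v *s g i) = v"
proof -
  let ?S = "{v. (\<Sum>i = 1..n. herm_inner (g i) v *s g i) = v}"
  have "vec.subspace ?S"
  proof (rule vec.subspaceI)
    show "0 \<in> ?S" by (simp add: herm_inner_def)
    show "x + y \<in> ?S" if "x \<in> ?S" "y \<in> ?S" for x y
    proof -
      have "herm_inner (g i) (x + y) = herm_inner (g i) x + herm_inner (g i) y" for i
        by (simp add: herm_inner_def algebra_simps sum.distrib)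
      with that show ?thesis
        by (simp add: vec.scale_left_distrib sum.distrib)
    qed
    show "c *s x \<in> ?S" if "x \<in> ?S" for c x
    proof -
      have "herm_inner (g i) (c *s x) = c * herm_inner (g i) x" for i
        by (simp add: herm_inner_def sum_distrib_left ac_simps)
      then have "(\<Sum>i = 1..n. herm_inner (g i) (c *s x) *s g i) =
          c *s (\<Sum>i = 1..n. herm_inner (g i) x *s g i)"
        by (simp add: vec.scale_sum_right)
      with that show ?thesis by simp
    qed
  qed
  moreover have "g ` {1..n} \<subseteq> ?S"
  proof
    fix x assume "x \<in> g ` {1..n}"
    then obtain j where j: "j \<in> {1..n}" "x = g j" by blast
    have "(\<Sum>i = 1..n. herm_inner (g i) (g j) *s g i) = (\<Sum>i = 1..n. if i = j then g i else 0)"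
      using assms j(1) by (intro sum.cong) (auto simp: is_onb_def)
    also have "\<dots> = g j" using j(1) by simp
    finally show "x \<in> ?S" using j by simp
  qed
  ultimately have "vec.span (g ` {1..n}) \<subseteq> ?S"
    by (simp add: vec.span_minimal)
  then show ?thesis
    using assms by (auto simp: is_onb_def)
qed

text \<open>Expanding the second factor of \<open>\<psi>\<close> along \<open>g\<close> gives a sum
  of products of some vectors \<open>w i\<close> with \<open>g i\<close>, and orthonormality of
  \<open>f\<close> allows a matrix that takes each \<open>f i\<close> to \<open>w i\<close>.\<close>

lemma max_entangled_cyclic:
  fixes f :: "nat \<Rightarrow> complex ^ 'a::finite" and g :: "nat \<Rightarrow> complex ^ 'b::finite"
    and \<psi> :: "complex ^ ('a \<times> 'b)"
  assumes "is_onb n f" and "is_onb n g"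
  obtains M :: "complex ^ 'a ^ 'a" where "\<psi> = op_tensor M (mat 1) *v max_entangled n f g"
proof
  \<comment> \<open>\<open>M\<close> sends \<open>f i\<close> to the partial inner product of \<open>\<psi>\<close> with \<open>g i\<close>.\<close>
  define w where "w i a = herm_inner (g i) (\<chi> b. \<psi> $ (a, b))" for i a
  define M :: "complex ^ 'a ^ 'a" where "M = (\<chi> a c. \<Sum>i = 1..n. w i a * cnj (f i $ c))"
  \<comment> \<open>\<open>M\<close> is the sum of the rank-one operators built from
    \<open>w i\<close> and the bra of \<open>f i\<close>; applied to \<open>f j\<close>, only the
    term with \<open>i = j\<close> survives.\<close>
  have Mf: "(\<Sum>c\<in>UNIV. M $ a $ c * f j $ c) = w j a" if "j \<in> {1..n}" for a j
  proof -
    have "(\<Sum>c\<in>UNIV. M $ a $ c * f j $ c) = (\<Sum>i = 1..n. w i a * herm_inner (f i) (f j))"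
      unfolding M_def herm_inner_def sum_distrib_left
      by (simp add: sum_distrib_right mult.assoc) (rule sum.swap)
    also have "\<dots> = (\<Sum>i = 1..n. if i = j then w i a else 0)"
      using assms(1) that by (intro sum.cong) (auto simp: is_onb_def)
    finally show ?thesis using that by simp
  qed
  have "(op_tensor M (mat 1) *v max_entangled n f g) $ (a, b) = \<psi> $ (a, b)" for a b
  proof -
    have "(op_tensor M (mat 1) *v max_entangled n f g) $ (a, b) =
      (\<Sum>c\<in>UNIV. \<Sum>j = 1..n. M $ a $ c * f j $ c * g j $ b)"
      by (simp add: op_tensor_left_mult_ket_nth max_entangled_def ket_tensor_def
          sum_distrib_left mult.assoc)
    also have "\<dots> = (\<Sum>j = 1..n. (\<Sum>c\<in>UNIV. M $ a $ c * f j $ c) * g j $ b)"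
      by (subst sum.swap) (simp add: sum_distrib_right)
    also have "\<dots> = (\<Sum>j = 1..n. w j a * g j $ b)"
      by (intro sum.cong) (simp_all add: Mf)
    \<comment> \<open>For fixed \<open>a\<close> the entries of \<open>\<psi>\<close> form a vector
      of the second factor, and the sum is its expansion along \<open>g\<close>.\<close>
    also have "\<dots> = (\<Sum>j = 1..n. herm_inner (g j) (\<chi> b. \<psi> $ (a, b)) *s g j) $ b"
      by (simp add: w_def)
    also have "\<dots> = \<psi> $ (a, b)"
      unfolding is_onb_expansion [OF assms(2)] by simp
    finally show ?thesis .
  qed
  then show "\<psi> = op_tensor M (mat 1) *v max_entangled n f g"
    by (simp add: vec_eq_iff)
qed

theorem theorem5p1:
  fixes n :: nat
    and basA :: "nat \<Rightarrow> complex ^ 'a::finite"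
    and basB :: "nat \<Rightarrow> complex ^ 'b::finite"
    and zE :: "complex ^ 'e::finite"
    and U_BE :: "complex ^ ('b \<times> 'e) ^ ('b \<times> 'e)"
    and T :: "complex ^ ('a \<times> 'e) ^ ('a \<times> 'e) \<Rightarrow> complex ^ ('a \<times> 'b) ^ ('a \<times> 'b)"
  assumes "CARD('a) = n" and "CARD('b) = n"
    and "is_onb n basA" and "is_onb n basB"
    and "norm zE = 1"
    and "is_unitary U_BE"
    and "EB_channel T"
    and "EB_degradable_with T (output_state U_BE zE (max_entangled n basA basB))"
  shows "\<forall>\<psi> :: complex ^ ('a \<times> 'b). EB_degradable_with T (output_state U_BE zE \<psi>)"
proof
  fix \<psi> :: "complex ^ ('a \<times> 'b)"
  \<comment> \<open>\<open>M\<close> depends on \<open>\<psi>\<close> and may be singular: the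
    equation for the maximally entangled input is only multiplied by \<open>M\<close> and its
    adjoint, never inverted.\<close>
  obtain M :: "complex ^ 'a ^ 'a"
    where "\<psi> = op_tensor M (mat 1) *v max_entangled n basA basB"
    using max_entangled_cyclic [OF assms(3,4)] .
  then show "EB_degradable_with T (output_state U_BE zE \<psi>)"
    using assms(8) EB_channel_conj_local [OF assms(7)]
    by (simp add: EB_degradable_with_def output_state_local tr_B_ket_proj_local
        tr_E_ket_proj_local)
qed

end
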